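(* The category $\mathcal{A}$ is isomorphic to the category $\mathcal{D}$ (both categories are defined in the context).
   Context: A left quasigroup $(L,\cdot)$ is a nonempty set $L$ with a binary operation such that for all $u,w\in L$ there is a unique $v\in L$ with $u\cdot v=w$; $uv$ means $u\cdot v$. Homomorphisms of left quasigroups are maps $f$ with $f(uv)=f(u)f(v)$. A ternary system $(M,\mu)$ is a nonempty set $M$ with a map $\mu:M^3\to M$; a homomorphism $h:(M,\mu)\to(M',\mu')$ of ternary systems is a map with $h(\mu(a,b,c))=\mu'(h(a),h(b),h(c))$ for all $a,b,c$. Category $\mathcal{A}$. Let $LMB$ be the collection of all triplets $(L,M,\pi)$ where $L$ is a left quasigroup, $M=(M,\mu)$ is a ternary system satisfying, for all $a,b,c,d\in M$, $$\mu(a,\mu(a,b,c),\mu(\mu(a,b,c),c,d))=\mu(a,b,\mu(b,c,d)),$$ $$\mu(\mu(a,b,c),c,d)=\mu(\mu(a,b,\mu(b,c,d)),\mu(b,c,d),d),$$ and $\pi:L\to M$ is a bijection. Write $(L,M,\pi)\sim(L',M',\pi')$ iff $L=L'$ as left quasigroups and $\pi'\pi^{-1}:M\to M'$ is a homomorphism of ternary systems; this is an equivalence relation. Objects of $\mathcal{A}$ are the equivalence classes $[(L,M,\pi)]$. For an object $V$, $L_V$ denotes the common left quasigroup of all its representatives. A morphism $f:V\to V'$ of $\mathcal{A}$ is a homomorphism $f:L_V\to L_{V'}$ of left quasigroups such that $\pi'f\pi^{-1}:M\to M'$ is a homomorphism of ternary systems for all representatives $(L_V,M,\pi)\in V$,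 $(L_{V'},M',\pi')\in V'$. Identities and composition are those of maps. Dynamical Yang-Baxter maps. Let $H,X$ be nonempty sets and $\phi:H\times X\to H$. A family $R(\lambda):X\times X\to X\times X$ ($\lambda\in H$) is a dynamical Yang-Baxter map associated with $H,X,\phi$ iff for every $\lambda\in H$, on $X^3$, $$R_{23}(\lambda)R_{13}(\phi(\lambda,X^{(2)}))R_{12}(\lambda)=R_{12}(\phi(\lambda,X^{(3)}))R_{13}(\lambda)R_{23}(\phi(\lambda,X^{(1)})),$$ where $R_{ij}(\lambda)$ applies $R(\lambda)$ to the $i$-th and $j$-th components and fixes the other, and $R_{ij}(\phi(\lambda,X^{(k)}))(u_1,u_2,u_3)=R_{ij}(\phi(\lambda,u_k))(u_1,u_2,u_3)$ with $\{i,j,k\}=\{1,2,3\}$. Category $\mathcal{D}$. Objects are the pairs $(L,R(\lambda))$ where $L=(L,\cdot)$ is a left quasigroup and $R(\lambda)$ ($\lambda\in L$) is a dynamical Yang-Baxter map associated with $L,L,(\cdot)$ such that, writing $R(\lambda)(u,v)=(\eta_\lambda(v)(u),\xi_\lambda(u)(v))$, the invariance condition $$(\lambda\,\xi_\lambda(u)(v))\,\eta_\lambda(v)(u)=(\lambda u)v\quad(\forall\lambda,u,v\in L)$$ holds. A morphism $f:(L,R(\lambda))\to(L',R'(\lambda'))$ is a homomorphism $f:L\to L'$ of left quasigroups with $R'(f(\lambda))(f\times f)=(f\times f)R(\lambda)$ for all $\lambda\in L$. Identities and composition are those of maps. *)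

theory Defs
  imports Main "HOL-Library.FuncSet"
begin

section \<open>Categories, functors, isomorphism of categories\<close>

text \<open>
  Hom-sets are a family indexed by source and target and need not be disjoint;
  accordingly composition and the morphism part of a functor take the objects as arguments:
  \<open>Comp C a b c g f\<close> is \<open>g \<circ> f\<close> for \<open>f : a \<rightarrow> b\<close> and \<open>g : b \<rightarrow> c\<close>.
\<close>

record ('o, 'm) cat =
  Ob :: "'o set"
  Hom :: "'o \<Rightarrow> 'o \<Rightarrow> 'm set"
  Ident :: "'o \<Rightarrow> 'm"
  Comp :: "'o \<Rightarrow> 'o \<Rightarrow> 'o \<Rightarrow> 'm \<Rightarrow> 'm \<Rightarrow> 'm"

definition is_category :: "('o, 'm) cat \<Rightarrow> bool" where
  "is_category C \<longleftrightarrow>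
     (\<forall>a\<in>Ob C. Ident C a \<in> Hom C a a) \<and>
     (\<forall>a\<in>Ob C. \<forall>b\<in>Ob C. \<forall>c\<in>Ob C. \<forall>f\<in>Hom C a b. \<forall>g\<in>Hom C b c.
        Comp C a b c g f \<in> Hom C a c) \<and>
     (\<forall>a\<in>Ob C. \<forall>b\<in>Ob C. \<forall>f\<in>Hom C a b.
        Comp C a a b f (Ident C a) = f \<and> Comp C a b b (Ident C b) f = f) \<and>
     (\<forall>a\<in>Ob C. \<forall>b\<in>Ob C. \<forall>c\<in>Ob C. \<forall>d\<in>Ob C.
        \<forall>f\<in>Hom C a b. \<forall>g\<in>Hom C b c. \<forall>h\<in>Hom C c d.
          Comp C a c d h (Comp C a b c g f) = Comp C a b d (Comp C b c d h g) f)"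

definition is_functor ::
  "('o, 'm) cat \<Rightarrow> ('p, 'n) cat \<Rightarrow> ('o \<Rightarrow> 'p) \<Rightarrow> ('o \<Rightarrow> 'o \<Rightarrow> 'm \<Rightarrow> 'n) \<Rightarrow> bool" where
  "is_functor C D F0 F1 \<longleftrightarrow>
     is_category C \<and> is_category D \<and>
     (\<forall>a\<in>Ob C. F0 a \<in> Ob D) \<and>
     (\<forall>a\<in>Ob C. \<forall>b\<in>Ob C. \<forall>f\<in>Hom C a b. F1 a b f \<in> Hom D (F0 a) (F0 b)) \<and>
     (\<forall>a\<in>Ob C. F1 a a (Ident C a) = Ident D (F0 a)) \<and>
     (\<forall>a\<in>Ob C. \<forall>b\<in>Ob C. \<forall>c\<in>Ob C. \<forall>f\<in>Hom C a b. \<forall>g\<in>Hom C b c.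
        F1 a c (Comp C a b c g f) = Comp D (F0 a) (F0 b) (F0 c) (F1 b c g) (F1 a b f))"

definition isomorphic_categories :: "('o, 'm) cat \<Rightarrow> ('p, 'n) cat \<Rightarrow> bool" where
  "isomorphic_categories C D \<longleftrightarrow>
     (\<exists>F0 F1 G0 G1. is_functor C D F0 F1 \<and> is_functor D C G0 G1 \<and>
        (\<forall>a\<in>Ob C. G0 (F0 a) = a) \<and>
        (\<forall>a\<in>Ob C. \<forall>b\<in>Ob C. \<forall>f\<in>Hom C a b. G1 (F0 a) (F0 b) (F1 a b f) = f) \<and>
        (\<forall>x\<in>Ob D. F0 (G0 x) = x) \<and>
        (\<forall>x\<in>Ob D. \<forall>y\<in>Ob D. \<forall>g\<in>Hom D x y. F1 (G0 x) (G0 y) (G1 x y g) = g))"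

section \<open>Left quasigroups and ternary systems\<close>

text \<open>
  The type \<open>'u\<close> plays the role of the universe: structures live on arbitrary nonempty subsets
  of it.  Operations and structure maps are extensional (\<open>undefined\<close> off their domain), so that
  HOL equality of records, maps and families is equality of the mathematical structures.
\<close>

record 'u lquasi =
  lcarrier :: "'u set"
  lmult :: "'u \<Rightarrow> 'u \<Rightarrow> 'u"

definition left_quasigroup :: "'u lquasi \<Rightarrow> bool" where
  "left_quasigroup L \<longleftrightarrow>
     lcarrier L \<noteq> {} \<and>
     lmult L \<in> lcarrier L \<rightarrow>\<^sub>E (lcarrier L \<rightarrow>\<^sub>E lcarrier L) \<and>
     (\<forall>u\<in>lcarrier L. \<forall>w\<in>lcarrier L. \<exists>!v. v \<in> lcarrier L \<and> lmult L u v = w)"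

definition lquasi_hom :: "'u lquasi \<Rightarrow> 'u lquasi \<Rightarrow> ('u \<Rightarrow> 'u) set" where
  "lquasi_hom L L' =
     {f \<in> lcarrier L \<rightarrow>\<^sub>E lcarrier L'.
        \<forall>u\<in>lcarrier L. \<forall>v\<in>lcarrier L. f (lmult L u v) = lmult L' (f u) (f v)}"

record 'u ternary =
  tcarrier :: "'u set"
  tmu :: "'u \<times> 'u \<times> 'u \<Rightarrow> 'u"

definition ternary_system :: "'u ternary \<Rightarrow> bool" where
  "ternary_system M \<longleftrightarrow>
     tcarrier M \<noteq> {} \<and>
     tmu M \<in> tcarrier M \<times> tcarrier M \<times> tcarrier M \<rightarrow>\<^sub>E tcarrier M"

text \<open>Only the values of \<open>h\<close> on the carrier matter here; extensionality is not demanded,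
  so that plain composites of maps can be used.\<close>

definition is_ternary_hom :: "'u ternary \<Rightarrow> 'u ternary \<Rightarrow> ('u \<Rightarrow> 'u) \<Rightarrow> bool" where
  "is_ternary_hom M M' h \<longleftrightarrow>
     h \<in> tcarrier M \<rightarrow> tcarrier M' \<and>
     (\<forall>a\<in>tcarrier M. \<forall>b\<in>tcarrier M. \<forall>c\<in>tcarrier M.
        h (tmu M (a, b, c)) = tmu M' (h a, h b, h c))"

section \<open>The category A\<close>

type_synonym 'u triplet = "'u lquasi \<times> 'u ternary \<times> ('u \<Rightarrow> 'u)"

definition LMB :: "'u triplet set" where
  "LMB = {(L, M, p).
     left_quasigroup L \<and> ternary_system M \<and>
     (\<forall>a\<in>tcarrier M. \<forall>b\<in>tcarrier M. \<forall>c\<in>tcarrier M. \<forall>d\<in>tcarrier M.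
        tmu M (a, tmu M (a, b, c), tmu M (tmu M (a, b, c), c, d))
          = tmu M (a, b, tmu M (b, c, d)) \<and>
        tmu M (tmu M (a, b, c), c, d)
          = tmu M (tmu M (a, b, tmu M (b, c, d)), tmu M (b, c, d), d)) \<and>
     p \<in> lcarrier L \<rightarrow>\<^sub>E tcarrier M \<and> bij_betw p (lcarrier L) (tcarrier M)}"

definition LMB_rel :: "('u triplet \<times> 'u triplet) set" where
  "LMB_rel = {((L, M, p), (L', M', p')).
     (L, M, p) \<in> LMB \<and> (L', M', p') \<in> LMB \<and> L = L' \<and>
     is_ternary_hom M M' (p' \<circ> inv_into (lcarrier L) p)}"

text \<open>The left quasigroup shared by all representatives of a class.\<close>

definition common_L :: "'u triplet set \<Rightarrow> 'u lquasi" where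
  "common_L V = (THE L. \<exists>M p. (L, M, p) \<in> V)"

definition A_hom :: "'u triplet set \<Rightarrow> 'u triplet set \<Rightarrow> ('u \<Rightarrow> 'u) set" where
  "A_hom V V' =
     {f \<in> lquasi_hom (common_L V) (common_L V').
        \<forall>L M p L' M' p'. (L, M, p) \<in> V \<longrightarrow> (L', M', p') \<in> V' \<longrightarrow>
          is_ternary_hom M M' (p' \<circ> f \<circ> inv_into (lcarrier L) p)}"

definition cat_A :: "('u triplet set, 'u \<Rightarrow> 'u) cat" where
  "cat_A = \<lparr> Ob = LMB // LMB_rel,
             Hom = A_hom,
             Ident = (\<lambda>V. restrict id (lcarrier (common_L V))),
             Comp = (\<lambda>V V' V'' g f. compose (lcarrier (common_L V)) g f) \<rparr>"

section \<open>Dynamical Yang-Baxter maps\<close>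

fun on12 :: "('x \<times> 'x \<Rightarrow> 'x \<times> 'x) \<Rightarrow> 'x \<times> 'x \<times> 'x \<Rightarrow> 'x \<times> 'x \<times> 'x" where
  "on12 S (u1, u2, u3) = (fst (S (u1, u2)), snd (S (u1, u2)), u3)"

fun on13 :: "('x \<times> 'x \<Rightarrow> 'x \<times> 'x) \<Rightarrow> 'x \<times> 'x \<times> 'x \<Rightarrow> 'x \<times> 'x \<times> 'x" where
  "on13 S (u1, u2, u3) = (fst (S (u1, u3)), u2, snd (S (u1, u3)))"

fun on23 :: "('x \<times> 'x \<Rightarrow> 'x \<times> 'x) \<Rightarrow> 'x \<times> 'x \<times> 'x \<Rightarrow> 'x \<times> 'x \<times> 'x" where
  "on23 S (u1, u2, u3) = (u1, fst (S (u2, u3)), snd (S (u2, u3)))"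

text \<open>\<open>dyn_ij R \<phi> l\<close> is \<open>R_ij(\<phi>(l, X^(k)))\<close>: the dynamical parameter is shifted
  by the remaining component of the argument.\<close>

fun dyn12 :: "('h \<Rightarrow> 'x \<times> 'x \<Rightarrow> 'x \<times> 'x) \<Rightarrow> ('h \<Rightarrow> 'x \<Rightarrow> 'h) \<Rightarrow> 'h \<Rightarrow> 'x \<times> 'x \<times> 'x \<Rightarrow> 'x \<times> 'x \<times> 'x"
  where "dyn12 R \<phi> l (u1, u2, u3) = on12 (R (\<phi> l u3)) (u1, u2, u3)"

fun dyn13 :: "('h \<Rightarrow> 'x \<times> 'x \<Rightarrow> 'x \<times> 'x) \<Rightarrow> ('h \<Rightarrow> 'x \<Rightarrow> 'h) \<Rightarrow> 'h \<Rightarrow> 'x \<times> 'x \<times> 'x \<Rightarrow> 'x \<times> 'x \<times> 'x"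
  where "dyn13 R \<phi> l (u1, u2, u3) = on13 (R (\<phi> l u2)) (u1, u2, u3)"

fun dyn23 :: "('h \<Rightarrow> 'x \<times> 'x \<Rightarrow> 'x \<times> 'x) \<Rightarrow> ('h \<Rightarrow> 'x \<Rightarrow> 'h) \<Rightarrow> 'h \<Rightarrow> 'x \<times> 'x \<times> 'x \<Rightarrow> 'x \<times> 'x \<times> 'x"
  where "dyn23 R \<phi> l (u1, u2, u3) = on23 (R (\<phi> l u1)) (u1, u2, u3)"

definition dynamical_YB_map ::
  "'h set \<Rightarrow> 'x set \<Rightarrow> ('h \<Rightarrow> 'x \<Rightarrow> 'h) \<Rightarrow> ('h \<Rightarrow> 'x \<times> 'x \<Rightarrow> 'x \<times> 'x) \<Rightarrow> bool" where
  "dynamical_YB_map H X \<phi> R \<longleftrightarrow>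
     H \<noteq> {} \<and> X \<noteq> {} \<and> \<phi> \<in> H \<rightarrow> (X \<rightarrow> H) \<and>
     R \<in> H \<rightarrow>\<^sub>E (X \<times> X \<rightarrow>\<^sub>E X \<times> X) \<and>
     (\<forall>l\<in>H. \<forall>w\<in>X \<times> X \<times> X.
        (on23 (R l) \<circ> dyn13 R \<phi> l \<circ> on12 (R l)) w
          = (dyn12 R \<phi> l \<circ> on13 (R l) \<circ> dyn23 R \<phi> l) w)"

section \<open>The category D\<close>

text \<open>\<open>R(l)(u, v) = (\<eta>_l(v)(u), \<xi>_l(u)(v))\<close>\<close>

definition eta :: "('h \<Rightarrow> 'x \<times> 'x \<Rightarrow> 'x \<times> 'x) \<Rightarrow> 'h \<Rightarrow> 'x \<Rightarrow> 'x \<Rightarrow> 'x" where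
  "eta R l v u = fst (R l (u, v))"

definition xi :: "('h \<Rightarrow> 'x \<times> 'x \<Rightarrow> 'x \<times> 'x) \<Rightarrow> 'h \<Rightarrow> 'x \<Rightarrow> 'x \<Rightarrow> 'x" where
  "xi R l u v = snd (R l (u, v))"

type_synonym 'u dpair = "'u lquasi \<times> ('u \<Rightarrow> 'u \<times> 'u \<Rightarrow> 'u \<times> 'u)"

definition D_ob :: "'u dpair set" where
  "D_ob = {(L, R).
     left_quasigroup L \<and>
     dynamical_YB_map (lcarrier L) (lcarrier L) (lmult L) R \<and>
     (\<forall>l\<in>lcarrier L. \<forall>u\<in>lcarrier L. \<forall>v\<in>lcarrier L.
        lmult L (lmult L l (xi R l u v)) (eta R l v u) = lmult L (lmult L l u) v)}"

fun D_hom :: "'u dpair \<Rightarrow> 'u dpair \<Rightarrow> ('u \<Rightarrow> 'u) set" where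
  "D_hom (L, R) (L', R') =
     {f \<in> lquasi_hom L L'.
        \<forall>l\<in>lcarrier L. \<forall>w\<in>lcarrier L \<times> lcarrier L.
          (R' (f l) \<circ> map_prod f f) w = (map_prod f f \<circ> R l) w}"

definition cat_D :: "('u dpair, 'u \<Rightarrow> 'u) cat" where
  "cat_D = \<lparr> Ob = D_ob,
             Hom = D_hom,
             Ident = (\<lambda>(L, R). restrict id (lcarrier L)),
             Comp = (\<lambda>x y z g f. compose (lcarrier (fst x)) g f) \<rparr>"

end

theory Submission imports Defs begin

text \<open>
  Why the two categories are isomorphic.  The bijection \<open>p\<close> of a triplet \<open>(L, M, p)\<close> only
  serves to carry the ternary operation of \<open>M\<close> over to \<open>L\<close>, and two triplets are equivalent
  exactly when they have the same \<open>L\<close> and carry over the same operation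
  (\<open>LMB_rel_iff_same_pullback\<close>).  So an object of the category A is a left quasigroup together
  with a ternary operation \<open>\<nu>\<close> on its carrier that satisfies the two laws, and a morphism is
  a map that preserves both structures (\<open>A_hom_class\<close>).

  Leaving the laws and the Yang-Baxter equation aside, a ternary operation \<open>\<nu>\<close> is the same thing
  as a family \<open>R\<close> with the invariance condition.  In a left quasigroup, a starting point \<open>l\<close> and a word \<open>u, v\<close> amount to the path \<open>l, l u, (l u) v\<close>, since
  the letters can be recovered by left division.  The invariance condition says that the letters
  \<open>\<xi>, \<eta>\<close> produced by \<open>R l\<close> describe a path \<open>l, l \<xi>, (l \<xi>) \<eta>\<close> with the same two end points.
  Hence \<open>R\<close> does nothing but replace the middle point of each path \<open>a, b, c\<close> by a new point
  \<open>\<nu> (a, b, c)\<close>, and every operation \<open>\<nu>\<close> arises in this way.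

  In these terms the two sides of the dynamical Yang-Baxter equation turn a path \<open>a, b, c, d\<close>
  into two paths from \<open>a\<close> to \<open>d\<close>.  The two laws for \<open>\<nu>\<close> say that these paths have
  the same second and the same third point (\<open>Yang_Baxter_iff_middle_laws\<close>).  The resulting
  bijection on objects leaves the underlying maps of morphisms unchanged
  (\<open>D_hom_iff_middle_hom\<close>), so that it is an isomorphism of categories
  (\<open>isomorphic_categoriesI\<close>).
\<close>

section \<open>Isomorphisms that keep the morphisms\<close>

text \<open>
  When the morphism sets, identities and composites agree literally along a bijection of
  objects, the category axioms hold on one side as soon as they hold on the other.
\<close>

lemma is_category_transfer:
  assumes D: "is_category D" and bij: "bij_betw G (Ob D) (Ob C)"
    and Hom: "\<And>x y. x \<in> Ob D \<Longrightarrow> y \<in> Ob D \<Longrightarrow> Hom C (G x) (G y) = Hom D x y"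
    and Ident: "\<And>x. x \<in> Ob D \<Longrightarrow> Ident C (G x) = Ident D x"
    and Comp: "\<And>x y z. x \<in> Ob D \<Longrightarrow> y \<in> Ob D \<Longrightarrow> z \<in> Ob D \<Longrightarrow>
                 Comp C (G x) (G y) (G z) = Comp D x y z"
  shows "is_category C"
proof -
  have Ob: "Ob C = G ` Ob D"
    using bij by (simp add: bij_betw_def)
  show ?thesis
    using D unfolding is_category_def Ob
    by (simp add: Hom Ident Comp)
qed

lemma isomorphic_categoriesI:
  assumes D: "is_category D" and bij: "bij_betw G (Ob D) (Ob C)"
    and Hom: "\<And>x y. x \<in> Ob D \<Longrightarrow> y \<in> Ob D \<Longrightarrow> Hom C (G x) (G y) = Hom D x y"
    and Ident: "\<And>x. x \<in> Ob D \<Longrightarrow> Ident C (G x) = Ident D x"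
    and Comp: "\<And>x y z. x \<in> Ob D \<Longrightarrow> y \<in> Ob D \<Longrightarrow> z \<in> Ob D \<Longrightarrow>
                 Comp C (G x) (G y) (G z) = Comp D x y z"
  shows "isomorphic_categories C D"
proof -
  have C: "is_category C"
    using is_category_transfer[OF assms] .
  define F where "F = inv_into (Ob D) G"
  have F: "F (G x) = x" if "x \<in> Ob D" for x
    using bij that by (simp add: F_def bij_betw_inv_into_left)
  have Ob: "Ob C = G ` Ob D"
    using bij by (simp add: bij_betw_def)
  have "is_functor D C G (\<lambda>_ _ f. f)"
    using C D by (simp add: is_functor_def Ob Hom Ident Comp)
  moreover have "is_functor C D F (\<lambda>_ _ f. f)"
    using C D by (simp add: is_functor_def Ob F Hom Ident Comp)
  ultimately show ?thesis
    unfolding isomorphic_categories_def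
    by (intro exI[of _ F] exI[of _ "\<lambda>_ _ f. f"] exI[of _ G] conjI) (auto simp: Ob F)
qed

section \<open>Left division\<close>

definition ldiv :: "'u lquasi \<Rightarrow> 'u \<Rightarrow> 'u \<Rightarrow> 'u" where
  "ldiv L u w = (THE v. v \<in> lcarrier L \<and> lmult L u v = w)"

locale left_quasi =
  fixes L :: "'u lquasi"
  assumes left_quasigroup: "left_quasigroup L"
begin

abbreviation X where "X \<equiv> lcarrier L"
abbreviation mult (infixl "\<cdot>" 70) where "a \<cdot> b \<equiv> lmult L a b"
abbreviation div_left (infixl "\<setminus>" 70) where "a \<setminus> b \<equiv> ldiv L a b"

lemma mult_closed [simp, intro]: "a \<in> X \<Longrightarrow> b \<in> X \<Longrightarrow> a \<cdot> b \<in> X"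
  using left_quasigroup unfolding left_quasigroup_def by (blast dest: PiE_mem)

lemma mult_cancel [simp]:
  "a \<in> X \<Longrightarrow> b \<in> X \<Longrightarrow> c \<in> X \<Longrightarrow> a \<cdot> b = a \<cdot> c \<longleftrightarrow> b = c"
  using left_quasigroup mult_closed unfolding left_quasigroup_def by blast

lemma
  assumes "a \<in> X" "b \<in> X"
  shows ldiv_closed [simp, intro]: "a \<setminus> b \<in> X"
    and mult_ldiv [simp]: "a \<cdot> (a \<setminus> b) = b"
proof -
  have "\<exists>!v. v \<in> X \<and> a \<cdot> v = b"
    using assms left_quasigroup by (simp add: left_quasigroup_def)
  from theI'[OF this] show "a \<setminus> b \<in> X" "a \<cdot> (a \<setminus> b) = b"
    by (simp_all add: ldiv_def)
qed

lemma ldiv_mult [simp]: "a \<in> X \<Longrightarrow> b \<in> X \<Longrightarrow> a \<setminus> (a \<cdot> b) = b"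
  by (metis ldiv_closed mult_cancel mult_closed mult_ldiv)

end

lemma lquasi_homD:
  assumes "f \<in> lquasi_hom L L'"
  shows "u \<in> lcarrier L \<Longrightarrow> f u \<in> lcarrier L'"
    and "u \<in> lcarrier L \<Longrightarrow> v \<in> lcarrier L \<Longrightarrow> f (lmult L u v) = lmult L' (f u) (f v)"
  using assms by (auto simp: lquasi_hom_def)

section \<open>Maps that move the middle point of a path\<close>

definition invariant_map :: "'u lquasi \<Rightarrow> ('u \<Rightarrow> 'u \<times> 'u \<Rightarrow> 'u \<times> 'u) \<Rightarrow> bool" where
  "invariant_map L R \<longleftrightarrow>
     R \<in> lcarrier L \<rightarrow>\<^sub>E (lcarrier L \<times> lcarrier L \<rightarrow>\<^sub>E lcarrier L \<times> lcarrier L) \<and>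
     (\<forall>l\<in>lcarrier L. \<forall>u\<in>lcarrier L. \<forall>v\<in>lcarrier L.
        lmult L (lmult L l (xi R l u v)) (eta R l v u) = lmult L (lmult L l u) v)"

definition middle :: "'u lquasi \<Rightarrow> ('u \<Rightarrow> 'u \<times> 'u \<Rightarrow> 'u \<times> 'u) \<Rightarrow> 'u ternary" where
  "middle L R =
     \<lparr> tcarrier = lcarrier L,
       tmu = (\<lambda>(a, b, c) \<in> lcarrier L \<times> lcarrier L \<times> lcarrier L.
                lmult L a (xi R a (ldiv L a b) (ldiv L b c))) \<rparr>"

definition map_of_middle :: "'u lquasi \<Rightarrow> 'u ternary \<Rightarrow> 'u \<Rightarrow> 'u \<times> 'u \<Rightarrow> 'u \<times> 'u" where
  "map_of_middle L M =
     (\<lambda>l \<in> lcarrier L. \<lambda>(u, v) \<in> lcarrier L \<times> lcarrier L.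
        let b = lmult L l u; c = lmult L b v; b' = tmu M (l, b, c)
        in (ldiv L b' c, ldiv L l b'))"

text \<open>
  The conditions on the ternary systems in \<open>LMB\<close>.  Two paths from \<open>a\<close> to \<open>d\<close> arise
  from \<open>a, b, c, d\<close> by replacing middle points; the first equation compares their second points,
  the second one their third points.
\<close>

definition middle_laws :: "'u ternary \<Rightarrow> bool" where
  "middle_laws M \<longleftrightarrow>
     (\<forall>a\<in>tcarrier M. \<forall>b\<in>tcarrier M. \<forall>c\<in>tcarrier M. \<forall>d\<in>tcarrier M.
        tmu M (a, tmu M (a, b, c), tmu M (tmu M (a, b, c), c, d))
          = tmu M (a, b, tmu M (b, c, d)) \<and>
        tmu M (tmu M (a, b, c), c, d)
          = tmu M (tmu M (a, b, tmu M (b, c, d)), tmu M (b, c, d), d))"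

lemma ternary_system_closed:
  "ternary_system M \<Longrightarrow> a \<in> tcarrier M \<Longrightarrow> b \<in> tcarrier M \<Longrightarrow> c \<in> tcarrier M
    \<Longrightarrow> tmu M (a, b, c) \<in> tcarrier M"
  unfolding ternary_system_def by (blast dest: PiE_mem)

lemma ternary_eqI:
  fixes M M' :: "'u ternary"
  assumes "ternary_system M" "ternary_system M'" "tcarrier M = tcarrier M'"
    and "\<And>a b c. a \<in> tcarrier M \<Longrightarrow> b \<in> tcarrier M \<Longrightarrow> c \<in> tcarrier M
           \<Longrightarrow> tmu M (a, b, c) = tmu M' (a, b, c)"
  shows "M = M'"
proof -
  have "tmu M = tmu M'"
    using assms unfolding ternary_system_def
    by (intro PiE_ext[of "tmu M" "tcarrier M \<times> tcarrier M \<times> tcarrier M" "\<lambda>_. tcarrier M"]) auto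
  with assms(3) show ?thesis
    by (intro ternary.equality) auto
qed

lemma apply_eq_eta_xi: "R l (u, v) = (eta R l v u, xi R l u v)"
  by (simp add: eta_def xi_def)

context left_quasi
begin

lemma
  assumes "invariant_map L R" "l \<in> X" "u \<in> X" "v \<in> X"
  shows xi_closed [intro]: "xi R l u v \<in> X"
    and eta_closed [intro]: "eta R l v u \<in> X"
    and invariance: "l \<cdot> xi R l u v \<cdot> eta R l v u = l \<cdot> u \<cdot> v"
    and mult_xi: "l \<cdot> xi R l u v = tmu (middle L R) (l, l \<cdot> u, l \<cdot> u \<cdot> v)"
proof -
  have "R l (u, v) \<in> X \<times> X"
    using assms unfolding invariant_map_def
    by (meson PiE_mem SigmaI)
  then show "xi R l u v \<in> X" "eta R l v u \<in> X"
    by (auto simp: xi_def eta_def)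
  show "l \<cdot> xi R l u v \<cdot> eta R l v u = l \<cdot> u \<cdot> v"
    using assms by (simp add: invariant_map_def)
  show "l \<cdot> xi R l u v = tmu (middle L R) (l, l \<cdot> u, l \<cdot> u \<cdot> v)"
    using assms by (simp add: middle_def)
qed

lemma ternary_system_middle:
  assumes "invariant_map L R"
  shows "ternary_system (middle L R)"
  using left_quasigroup xi_closed[OF assms]
  by (auto simp: ternary_system_def middle_def left_quasigroup_def)

lemma invariant_map_of_middle:
  assumes "ternary_system M" "tcarrier M = X"
  shows "invariant_map L (map_of_middle L M)"
  using ternary_system_closed[OF assms(1)] assms(2)
  by (auto simp: invariant_map_def map_of_middle_def xi_def eta_def Let_def)

lemma middle_of_map_of_middle:
  assumes "ternary_system M" "tcarrier M = X"
  shows "middle L (map_of_middle L M) = M"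
proof (rule ternary_eqI)
  show "ternary_system (middle L (map_of_middle L M))"
    using assms by (intro ternary_system_middle invariant_map_of_middle)
qed (use assms ternary_system_closed[OF assms(1)] in
      \<open>auto simp: middle_def map_of_middle_def xi_def Let_def\<close>)

text \<open>
  The middle point determines the letter \<open>\<xi>\<close> by left division; the invariance condition then
  determines \<open>\<eta>\<close>.
\<close>

lemma invariant_map_eqI:
  assumes R: "invariant_map L R" and R': "invariant_map L R'"
    and eq: "middle L R = middle L R'"
  shows "R = R'"
proof -
  have "R l (u, v) = R' l (u, v)" if "l \<in> X" "u \<in> X" "v \<in> X" for l u v
  proof -
    have "l \<cdot> xi R l u v = l \<cdot> xi R' l u v"
      using that eq by (simp add: mult_xi[OF R] mult_xi[OF R'])
    then have xi: "xi R l u v = xi R' l u v"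
      using that xi_closed[OF R] xi_closed[OF R'] by simp
    have "l \<cdot> xi R l u v \<cdot> eta R l v u = l \<cdot> xi R l u v \<cdot> eta R' l v u"
      using invariance[OF R that] invariance[OF R' that] xi by simp
    then have "eta R l v u = eta R' l v u"
      using that xi_closed[OF R] eta_closed[OF R] eta_closed[OF R'] by simp
    with xi show ?thesis
      by (simp add: apply_eq_eta_xi[of R] apply_eq_eta_xi[of R'])
  qed
  moreover have "R l \<in> X \<times> X \<rightarrow>\<^sub>E X \<times> X" "R' l \<in> X \<times> X \<rightarrow>\<^sub>E X \<times> X" if "l \<in> X" for l
    using that R R' PiE_mem[of _ X "\<lambda>_. X \<times> X \<rightarrow>\<^sub>E X \<times> X" l] by (simp_all add: invariant_map_def)
  ultimately have "R l = R' l" if "l \<in> X" for l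
    using that by (intro PiE_ext[of "R l" "X \<times> X" "\<lambda>_. X \<times> X"]) auto
  then show ?thesis
    using R R' unfolding invariant_map_def
    by (intro PiE_ext[of R X]) auto
qed

section \<open>The Yang-Baxter equation in terms of paths\<close>

text \<open>
  The outputs of \<open>R\<close> come in reversed order: by the invariance condition the second component is
  the first step of the new path.  Three strands that have all crossed are therefore read from
  right to left.
\<close>

definition reverse_path :: "'u \<Rightarrow> 'u \<times> 'u \<times> 'u \<Rightarrow> 'u \<times> 'u \<times> 'u" where
  "reverse_path l = (\<lambda>(u1, u2, u3). (l \<cdot> u3, l \<cdot> u3 \<cdot> u2, l \<cdot> u3 \<cdot> u2 \<cdot> u1))"

lemma inj_on_reverse_path: "l \<in> X \<Longrightarrow> inj_on (reverse_path l) (X \<times> X \<times> X)"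
  by (auto simp: inj_on_def reverse_path_def)

lemma
  assumes R: "invariant_map L R" and in_X: "l \<in> X" "u1 \<in> X" "u2 \<in> X" "u3 \<in> X"
  defines "\<nu> \<equiv> tmu (middle L R)"
  defines "b \<equiv> l \<cdot> u1"
  defines "c \<equiv> b \<cdot> u2"
  defines "d \<equiv> c \<cdot> u3"
  shows Yang_Baxter_left_closed:
      "(on23 (R l) \<circ> dyn13 R (lmult L) l \<circ> on12 (R l)) (u1, u2, u3) \<in> X \<times> X \<times> X" (is ?left_in)
    and Yang_Baxter_left_path:
      "reverse_path l ((on23 (R l) \<circ> dyn13 R (lmult L) l \<circ> on12 (R l)) (u1, u2, u3))
         = (\<nu> (l, \<nu> (l, b, c), \<nu> (\<nu> (l, b, c), c, d)), \<nu> (\<nu> (l, b, c), c, d), d)" (is ?left_path)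
    and Yang_Baxter_right_closed:
      "(dyn12 R (lmult L) l \<circ> on13 (R l) \<circ> dyn23 R (lmult L) l) (u1, u2, u3) \<in> X \<times> X \<times> X"
      (is ?right_in)
    and Yang_Baxter_right_path:
      "reverse_path l ((dyn12 R (lmult L) l \<circ> on13 (R l) \<circ> dyn23 R (lmult L) l) (u1, u2, u3))
         = (\<nu> (l, b, \<nu> (b, c, d)), \<nu> (\<nu> (l, b, \<nu> (b, c, d)), \<nu> (b, c, d), d), d)"
      (is ?right_path)
proof -
  note closed = xi_closed[OF R] eta_closed[OF R]
  note step = mult_xi[OF R, folded \<nu>_def] invariance[OF R]
  have bcd: "b \<in> X" "c \<in> X" "d \<in> X"
    using in_X by (simp_all add: b_def c_def d_def)

  \<comment> \<open>Left side: the three maps move the points of the path in the order second, third, second.\<close>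
  define v1 where "v1 = eta R l u2 u1"
  define v2 where "v2 = xi R l u1 u2"
  have v: "v1 \<in> X" "v2 \<in> X" and lv2: "l \<cdot> v2 = \<nu> (l, b, c)"
    using in_X by (auto simp: v1_def v2_def closed step(1) b_def c_def)
  have v1: "l \<cdot> v2 \<cdot> v1 = c"
    using step(2)[of l u1 u2] in_X by (simp add: v1_def v2_def b_def c_def)
  define w1 where "w1 = eta R (l \<cdot> v2) u3 v1"
  define w3 where "w3 = xi R (l \<cdot> v2) v1 u3"
  have w: "w1 \<in> X" "w3 \<in> X"
    using in_X v by (auto simp: w1_def w3_def closed)
  have w3: "l \<cdot> v2 \<cdot> w3 = \<nu> (\<nu> (l, b, c), c, d)"
    using step(1)[of "l \<cdot> v2" v1 u3] mult_closed[OF in_X(1) v(2)] in_X v v1 lv2 by (simp add: w3_def d_def)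
  have w1: "l \<cdot> v2 \<cdot> w3 \<cdot> w1 = d"
    using step(2)[of "l \<cdot> v2" v1 u3] in_X v v1 by (simp add: w1_def w3_def d_def)
  define x2 where "x2 = eta R l w3 v2"
  define x3 where "x3 = xi R l v2 w3"
  have x: "x2 \<in> X" "x3 \<in> X"
    using in_X v w by (auto simp: x2_def x3_def closed)
  have x3: "l \<cdot> x3 = \<nu> (l, \<nu> (l, b, c), \<nu> (\<nu> (l, b, c), c, d))"
    using step(1)[of l v2 w3] in_X v w w3 lv2 by (simp add: x3_def)
  have x2: "l \<cdot> x3 \<cdot> x2 = l \<cdot> v2 \<cdot> w3"
    using step(2)[of l v2 w3] in_X v w by (simp add: x2_def x3_def)
  have left: "(on23 (R l) \<circ> dyn13 R (lmult L) l \<circ> on12 (R l)) (u1, u2, u3) = (w1, x2, x3)"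
    by (simp add: apply_eq_eta_xi[of R] v1_def v2_def w1_def w3_def x2_def x3_def)
  show ?left_in
    unfolding left using w x by simp
  show ?left_path
    unfolding left reverse_path_def using x3 x2 w1 w3 by simp

  \<comment> \<open>Right side: here the order is third, second, third.\<close>
  define y2 where "y2 = eta R b u3 u2"
  define y3 where "y3 = xi R b u2 u3"
  have y: "y2 \<in> X" "y3 \<in> X" and y3: "b \<cdot> y3 = \<nu> (b, c, d)"
    using in_X bcd by (auto simp: y2_def y3_def closed step(1) c_def d_def)
  have y2: "b \<cdot> y3 \<cdot> y2 = d"
    using step(2)[of b u2 u3] in_X bcd by (simp add: y2_def y3_def c_def d_def)
  define z1 where "z1 = eta R l y3 u1"
  define z3 where "z3 = xi R l u1 y3"
  have z: "z1 \<in> X" "z3 \<in> X"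
    using in_X y by (auto simp: z1_def z3_def closed)
  have z3: "l \<cdot> z3 = \<nu> (l, b, \<nu> (b, c, d))"
    using step(1)[of l u1 y3] in_X y y3 by (simp add: z3_def b_def)
  have z1: "l \<cdot> z3 \<cdot> z1 = \<nu> (b, c, d)"
    using step(2)[of l u1 y3] in_X y y3 by (simp add: z1_def z3_def b_def)
  define t1 where "t1 = eta R (l \<cdot> z3) y2 z1"
  define t2 where "t2 = xi R (l \<cdot> z3) z1 y2"
  have t: "t1 \<in> X" "t2 \<in> X"
    using in_X y z by (auto simp: t1_def t2_def closed)
  have t2: "l \<cdot> z3 \<cdot> t2 = \<nu> (\<nu> (l, b, \<nu> (b, c, d)), \<nu> (b, c, d), d)"
    using step(1)[of "l \<cdot> z3" z1 y2] mult_closed[OF in_X(1) z(2)] in_X y z z1 z3 y2 y3 by (simp add: t2_def)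
  have t1: "l \<cdot> z3 \<cdot> t2 \<cdot> t1 = d"
    using step(2)[of "l \<cdot> z3" z1 y2] in_X y z z1 y2 y3 by (simp add: t1_def t2_def)
  have right: "(dyn12 R (lmult L) l \<circ> on13 (R l) \<circ> dyn23 R (lmult L) l) (u1, u2, u3) = (t1, t2, z3)"
    by (simp add: apply_eq_eta_xi[of R] y2_def y3_def z1_def z3_def t1_def t2_def b_def)
  show ?right_in
    unfolding right using z t by simp
  show ?right_path
    unfolding right reverse_path_def using z3 t1 t2 by simp
qed

text \<open>
  Both sides of the equation are triples of letters, and a triple is determined by its path.
  Every path \<open>a, b, c, d\<close> arises from the letters \<open>a \<setminus> b, b \<setminus> c, c \<setminus> d\<close>, which gives the
  laws at all arguments.
\<close>

lemma Yang_Baxter_iff_middle_laws: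
  assumes R: "invariant_map L R"
  shows "dynamical_YB_map X X (lmult L) R \<longleftrightarrow> middle_laws (middle L R)"
proof -
  let ?left = "\<lambda>l. on23 (R l) \<circ> dyn13 R (lmult L) l \<circ> on12 (R l)"
  let ?right = "\<lambda>l. dyn12 R (lmult L) l \<circ> on13 (R l) \<circ> dyn23 R (lmult L) l"
  define \<nu> where "\<nu> = tmu (middle L R)"
  define laws where "laws a b c d \<longleftrightarrow>
      \<nu> (a, \<nu> (a, b, c), \<nu> (\<nu> (a, b, c), c, d)) = \<nu> (a, b, \<nu> (b, c, d)) \<and>
      \<nu> (\<nu> (a, b, c), c, d) = \<nu> (\<nu> (a, b, \<nu> (b, c, d)), \<nu> (b, c, d), d)" for a b c d
  have pointwise: "?left l (u1, u2, u3) = ?right l (u1, u2, u3) \<longleftrightarrow>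
      laws l (l \<cdot> u1) (l \<cdot> u1 \<cdot> u2) (l \<cdot> u1 \<cdot> u2 \<cdot> u3)"
    if in_X: "l \<in> X" "u1 \<in> X" "u2 \<in> X" "u3 \<in> X" for l u1 u2 u3
  proof -
    have "?left l (u1, u2, u3) = ?right l (u1, u2, u3) \<longleftrightarrow>
        reverse_path l (?left l (u1, u2, u3)) = reverse_path l (?right l (u1, u2, u3))"
      using inj_on_eq_iff[OF inj_on_reverse_path[OF in_X(1)]
          Yang_Baxter_left_closed[OF R in_X] Yang_Baxter_right_closed[OF R in_X]] by (rule sym)
    then show ?thesis
      unfolding Yang_Baxter_left_path[OF R in_X] Yang_Baxter_right_path[OF R in_X]
        laws_def \<nu>_def by simp
  qed
  have "dynamical_YB_map X X (lmult L) R \<longleftrightarrow>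
      (\<forall>l\<in>X. \<forall>u1\<in>X. \<forall>u2\<in>X. \<forall>u3\<in>X. ?left l (u1, u2, u3) = ?right l (u1, u2, u3))"
    using R left_quasigroup
    unfolding dynamical_YB_map_def invariant_map_def left_quasigroup_def
    by (auto simp del: comp_apply)
  also have "\<dots> \<longleftrightarrow> (\<forall>a\<in>X. \<forall>b\<in>X. \<forall>c\<in>X. \<forall>d\<in>X. laws a b c d)"
  proof
    assume *: "\<forall>l\<in>X. \<forall>u1\<in>X. \<forall>u2\<in>X. \<forall>u3\<in>X. ?left l (u1, u2, u3) = ?right l (u1, u2, u3)"
    show "\<forall>a\<in>X. \<forall>b\<in>X. \<forall>c\<in>X. \<forall>d\<in>X. laws a b c d"
    proof (intro ballI)
      fix a b c d
      assume in_X: "a \<in> X" "b \<in> X" "c \<in> X" "d \<in> X"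
      have "laws a (a \<cdot> (a \<setminus> b)) (a \<cdot> (a \<setminus> b) \<cdot> (b \<setminus> c))
              (a \<cdot> (a \<setminus> b) \<cdot> (b \<setminus> c) \<cdot> (c \<setminus> d))"
        using in_X * by (subst pointwise[symmetric]) (auto simp del: comp_apply)
      with in_X show "laws a b c d" by simp
    qed
  next
    assume "\<forall>a\<in>X. \<forall>b\<in>X. \<forall>c\<in>X. \<forall>d\<in>X. laws a b c d"
    then show "\<forall>l\<in>X. \<forall>u1\<in>X. \<forall>u2\<in>X. \<forall>u3\<in>X. ?left l (u1, u2, u3) = ?right l (u1, u2, u3)"
      by (intro ballI) (subst pointwise, auto)
  qed
  also have "\<dots> \<longleftrightarrow> middle_laws (middle L R)"
    unfolding middle_laws_def laws_def \<nu>_def by (simp add: middle_def)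
  finally show ?thesis .
qed

end

lemma D_ob_iff:
  "(L, R) \<in> D_ob \<longleftrightarrow> left_quasigroup L \<and> invariant_map L R \<and> middle_laws (middle L R)"
proof (cases "left_quasigroup L")
  case True
  then interpret left_quasi L by unfold_locales
  have "(L, R) \<in> D_ob \<longleftrightarrow> invariant_map L R \<and> dynamical_YB_map X X (lmult L) R"
    using True by (auto simp: D_ob_def invariant_map_def dynamical_YB_map_def)
  then show ?thesis
    using True Yang_Baxter_iff_middle_laws by blast
qed (simp add: D_ob_def)

text \<open>
  Preserving \<open>R\<close> means preserving both output letters.  Under a homomorphism of left quasigroups
  this is the same as preserving the middle point: the last letter is then forced, because both
  paths end at the image of the same point.
\<close>

lemma D_hom_iff_middle_hom:
  assumes "left_quasigroup L" "left_quasigroup L'"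
    and R: "invariant_map L R" and R': "invariant_map L' R'"
  shows "f \<in> D_hom (L, R) (L', R') \<longleftrightarrow>
    f \<in> lquasi_hom L L' \<and> is_ternary_hom (middle L R) (middle L' R') f"
proof (cases "f \<in> lquasi_hom L L'")
  case True
  interpret left_quasi L using assms by unfold_locales
  interpret L': left_quasi L' using assms by unfold_locales
  note f = lquasi_homD[OF True]
  note closed = xi_closed[OF R] eta_closed[OF R] L'.xi_closed[OF R'] L'.eta_closed[OF R']
  let ?pres_R = "\<lambda>l u v. xi R' (f l) (f u) (f v) = f (xi R l u v) \<and>
                         eta R' (f l) (f v) (f u) = f (eta R l v u)"
  let ?pres_mid = "\<lambda>a b c. f (tmu (middle L R) (a, b, c)) = tmu (middle L' R') (f a, f b, f c)"
  have pointwise: "?pres_R l u v \<longleftrightarrow> ?pres_mid l (l \<cdot> u) (l \<cdot> u \<cdot> v)"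
    if in_X: "l \<in> X" "u \<in> X" "v \<in> X" for l u v
  proof -
    let ?\<xi>' = "xi R' (f l) (f u) (f v)" and ?\<eta>' = "eta R' (f l) (f v) (f u)"
    have "?pres_mid l (l \<cdot> u) (l \<cdot> u \<cdot> v) \<longleftrightarrow> lmult L' (f l) (f (xi R l u v)) = lmult L' (f l) ?\<xi>'"
      using in_X by (simp add: f closed L'.mult_xi[OF R'] flip: mult_xi[OF R])
    also have "\<dots> \<longleftrightarrow> ?\<xi>' = f (xi R l u v)"
      using in_X by (auto simp: f closed)
    also have "\<dots> \<longleftrightarrow> ?pres_R l u v"
    proof -
      have "?\<eta>' = f (eta R l v u)" if xi: "?\<xi>' = f (xi R l u v)"
      proof -
        have "lmult L' (lmult L' (f l) ?\<xi>') ?\<eta>' = f (l \<cdot> u \<cdot> v)"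
          using in_X by (simp add: f L'.invariance[OF R'])
        also have "\<dots> = f (l \<cdot> xi R l u v \<cdot> eta R l v u)"
          using in_X by (simp add: invariance[OF R])
        also have "\<dots> = lmult L' (lmult L' (f l) ?\<xi>') (f (eta R l v u))"
          using in_X xi by (simp add: f closed)
        finally show ?thesis
          using in_X by (simp add: f closed)
      qed
      then show ?thesis by blast
    qed
    finally show ?thesis by simp
  qed
  have "f \<in> D_hom (L, R) (L', R') \<longleftrightarrow> (\<forall>l\<in>X. \<forall>u\<in>X. \<forall>v\<in>X. ?pres_R l u v)"
    using True by (auto simp: apply_eq_eta_xi[of R] apply_eq_eta_xi[of R'])
  also have "\<dots> \<longleftrightarrow> (\<forall>a\<in>X. \<forall>b\<in>X. \<forall>c\<in>X. ?pres_mid a b c)"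
  proof
    assume *: "\<forall>l\<in>X. \<forall>u\<in>X. \<forall>v\<in>X. ?pres_R l u v"
    show "\<forall>a\<in>X. \<forall>b\<in>X. \<forall>c\<in>X. ?pres_mid a b c"
    proof (intro ballI)
      fix a b c
      assume "a \<in> X" "b \<in> X" "c \<in> X"
      then show "?pres_mid a b c"
        using pointwise[of a "a \<setminus> b" "b \<setminus> c"] * by simp
    qed
  next
    assume *: "\<forall>a\<in>X. \<forall>b\<in>X. \<forall>c\<in>X. ?pres_mid a b c"
    show "\<forall>l\<in>X. \<forall>u\<in>X. \<forall>v\<in>X. ?pres_R l u v"
    proof (intro ballI)
      fix l u v
      assume "l \<in> X" "u \<in> X" "v \<in> X"
      then show "?pres_R l u v"
        using * by (subst pointwise) auto
    qed
  qed
  also have "\<dots> \<longleftrightarrow> f \<in> lquasi_hom L L' \<and> is_ternary_hom (middle L R) (middle L' R') f"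
    using True by (auto simp: is_ternary_hom_def middle_def f)
  finally show ?thesis .
qed simp

lemma is_category_cat_D: "is_category cat_D"
proof -
  have ident: "restrict id (lcarrier L) \<in> D_hom (L, R) (L, R)" if "(L, R) \<in> D_ob" for L R
  proof -
    interpret left_quasi L using that by unfold_locales (simp add: D_ob_def)
    have "invariant_map L R" using that by (simp add: D_ob_iff)
    then show ?thesis
      by (auto simp: lquasi_hom_def apply_eq_eta_xi[of R] xi_closed eta_closed)
  qed
  have comp: "compose (lcarrier L) g f \<in> D_hom (L, R) (L'', R'')"
    if obs: "(L, R) \<in> D_ob" "(L', R') \<in> D_ob"
      and hom: "f \<in> D_hom (L, R) (L', R')" "g \<in> D_hom (L', R') (L'', R'')"
    for L R L' R' L'' R'' f g
  proof -
    interpret left_quasi L using obs by unfold_locales (simp add: D_ob_def)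
    have R: "invariant_map L R" using obs by (simp add: D_ob_iff)
    have f: "f \<in> lquasi_hom L L'" and g: "g \<in> lquasi_hom L' L''"
      using hom by auto
    have fR: "R' (f l) (f u, f v) = map_prod f f (R l (u, v))"
      if "l \<in> X" "u \<in> X" "v \<in> X" for l u v
      using hom(1) that by force
    have gR: "R'' (g l) (g u, g v) = map_prod g g (R' l (u, v))"
      if "l \<in> lcarrier L'" "u \<in> lcarrier L'" "v \<in> lcarrier L'" for l u v
      using hom(2) that by force
    have "compose X g f \<in> lquasi_hom L L''"
      using lquasi_homD[OF f] lquasi_homD[OF g] by (auto simp: lquasi_hom_def compose_def)
    moreover have "R'' (compose X g f l) (compose X g f u, compose X g f v)
        = map_prod (compose X g f) (compose X g f) (R l (u, v))"
      if in_X: "l \<in> X" "u \<in> X" "v \<in> X" for l u v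
      using in_X xi_closed[OF R in_X] eta_closed[OF R in_X]
      by (simp add: compose_eq lquasi_homD[OF f] gR fR apply_eq_eta_xi[of R])
    ultimately show ?thesis by auto
  qed
  have ext: "f \<in> lcarrier (fst x) \<rightarrow>\<^sub>E lcarrier (fst y)" if "f \<in> D_hom x y" for f
    and x y :: "'a dpair"
    using that by (cases x; cases y) (simp add: lquasi_hom_def)
  show ?thesis
    unfolding is_category_def cat_D_def
  proof (simp, intro conjI ballI)
    fix x :: "'a dpair" assume "x \<in> D_ob"
    then show "(case x of (L, R) \<Rightarrow> restrict id (lcarrier L)) \<in> D_hom x x"
      using ident by (cases x) (simp del: D_hom.simps)
  next
    fix x y z :: "'a dpair" and f g
    assume "x \<in> D_ob" "y \<in> D_ob" "f \<in> D_hom x y" "g \<in> D_hom y z"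
    then show "compose (lcarrier (fst x)) g f \<in> D_hom x z"
      using comp by (cases x; cases y; cases z) (simp del: D_hom.simps)
  next
    fix x y :: "'a dpair" and f
    assume "f \<in> D_hom x y"
    from ext[OF this]
    show "compose (lcarrier (fst x)) f (case x of (L, R) \<Rightarrow> restrict id (lcarrier L)) = f"
      and "compose (lcarrier (fst x)) (case y of (L, R) \<Rightarrow> restrict id (lcarrier L)) f = f"
      by (auto simp: compose_def split_beta fun_eq_iff PiE_def extensional_def)
  next
    fix x y z w :: "'a dpair" and f g h
    assume "f \<in> D_hom x y"
    from ext[OF this]
    show "compose (lcarrier (fst x)) h (compose (lcarrier (fst x)) g f)
        = compose (lcarrier (fst x)) (compose (lcarrier (fst y)) h g) f"
      by (intro compose_assoc[of _ _ "lcarrier (fst y)"]) (auto simp: PiE_def)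
  qed
qed

section \<open>Carrying a ternary system over to the left quasigroup\<close>

definition pullback :: "'u set \<Rightarrow> 'u ternary \<Rightarrow> ('u \<Rightarrow> 'u) \<Rightarrow> 'u ternary" where
  "pullback X M p =
     \<lparr> tcarrier = X,
       tmu = (\<lambda>(a, b, c) \<in> X \<times> X \<times> X. inv_into X p (tmu M (p a, p b, p c))) \<rparr>"

lemma tcarrier_pullback [simp]: "tcarrier (pullback X M p) = X"
  by (simp add: pullback_def)

lemma LMB_iff:
  "(L, M, p) \<in> LMB \<longleftrightarrow> left_quasigroup L \<and> ternary_system M \<and> middle_laws M \<and>
     p \<in> lcarrier L \<rightarrow>\<^sub>E tcarrier M \<and> bij_betw p (lcarrier L) (tcarrier M)"
  by (simp add: LMB_def middle_laws_def)

context
  fixes X :: "'u set" and M :: "'u ternary" and p :: "'u \<Rightarrow> 'u"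
  assumes M: "ternary_system M" and p: "bij_betw p X (tcarrier M)"
begin

lemma
  shows bij_closed: "a \<in> X \<Longrightarrow> p a \<in> tcarrier M"
    and inv_bij_closed: "x \<in> tcarrier M \<Longrightarrow> inv_into X p x \<in> X"
    and bij_inv: "x \<in> tcarrier M \<Longrightarrow> p (inv_into X p x) = x"
    and inv_bij: "a \<in> X \<Longrightarrow> inv_into X p (p a) = a"
  using p by (auto simp: bij_betw_apply bij_betw_inv_into_right bij_betw_inv_into_left
      bij_betw_apply[OF bij_betw_inv_into])

lemmas bij_simps = bij_closed inv_bij_closed bij_inv inv_bij ternary_system_closed[OF M]

lemma ternary_system_pullback: "ternary_system (pullback X M p)"
proof -
  have "X \<noteq> {}"
    using M p by (auto simp: ternary_system_def bij_betw_def)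
  then show ?thesis
    by (auto simp: ternary_system_def pullback_def bij_simps)
qed

lemma middle_laws_pullback:
  assumes "middle_laws M"
  shows "middle_laws (pullback X M p)"
  unfolding middle_laws_def
proof (intro ballI)
  fix a b c d
  assume "a \<in> tcarrier (pullback X M p)" "b \<in> tcarrier (pullback X M p)"
    "c \<in> tcarrier (pullback X M p)" "d \<in> tcarrier (pullback X M p)"
  then have in_X: "a \<in> X" "b \<in> X" "c \<in> X" "d \<in> X"
    by simp_all
  let ?\<mu> = "tmu M" and ?a = "p a" and ?b = "p b" and ?c = "p c" and ?d = "p d"
  have "?\<mu> (?a, ?\<mu> (?a, ?b, ?c), ?\<mu> (?\<mu> (?a, ?b, ?c), ?c, ?d))
        = ?\<mu> (?a, ?b, ?\<mu> (?b, ?c, ?d))"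
    and "?\<mu> (?\<mu> (?a, ?b, ?c), ?c, ?d)
        = ?\<mu> (?\<mu> (?a, ?b, ?\<mu> (?b, ?c, ?d)), ?\<mu> (?b, ?c, ?d), ?d)"
    using assms in_X unfolding middle_laws_def by (blast intro: bij_closed)+
  then show "tmu (pullback X M p) (a, tmu (pullback X M p) (a, b, c),
        tmu (pullback X M p) (tmu (pullback X M p) (a, b, c), c, d))
      = tmu (pullback X M p) (a, b, tmu (pullback X M p) (b, c, d)) \<and>
    tmu (pullback X M p) (tmu (pullback X M p) (a, b, c), c, d)
      = tmu (pullback X M p) (tmu (pullback X M p) (a, b, tmu (pullback X M p) (b, c, d)),
          tmu (pullback X M p) (b, c, d), d)"
    using in_X by (simp add: pullback_def bij_simps)
qed

end

text \<open>
  Conjugating a map by the structure bijections does not affect whether it preserves the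
  operations.  For the identity map this shows that equivalent triplets have equal pullbacks.
\<close>

lemma is_ternary_hom_conj_iff:
  assumes M: "ternary_system M" and p: "bij_betw p X (tcarrier M)"
    and M': "ternary_system M'" and p': "bij_betw p' X' (tcarrier M')"
    and f: "f \<in> X \<rightarrow> X'"
  shows "is_ternary_hom M M' (p' \<circ> f \<circ> inv_into X p)
      \<longleftrightarrow> is_ternary_hom (pullback X M p) (pullback X' M' p') f"
proof -
  note s = bij_simps[OF M p] bij_simps[OF M' p']
  have fX: "f a \<in> X'" if "a \<in> X" for a using f that by blast
  have carrier: "tcarrier M = p ` X"
    using p by (simp add: bij_betw_def)
  have "p' (f (inv_into X p (tmu M (p a, p b, p c)))) = tmu M' (p' (f a), p' (f b), p' (f c)) \<longleftrightarrow>
      f (inv_into X p (tmu M (p a, p b, p c))) = inv_into X' p' (tmu M' (p' (f a), p' (f b), p' (f c)))"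
    if "a \<in> X" "b \<in> X" "c \<in> X" for a b c
    using that by (metis fX s)
  then show ?thesis
    unfolding is_ternary_hom_def carrier ball_simps
    by (auto simp: pullback_def s fX)
qed

lemma is_ternary_hom_id_iff:
  fixes M M' :: "'u ternary"
  assumes "ternary_system M" "ternary_system M'" "tcarrier M = tcarrier M'"
  shows "is_ternary_hom M M' id \<longleftrightarrow> M = M'"
  using assms ternary_eqI[OF assms] by (auto simp: is_ternary_hom_def)

lemma LMB_rel_iff_same_pullback:
  "((L, M, p), (L', M', p')) \<in> LMB_rel \<longleftrightarrow>
     (L, M, p) \<in> LMB \<and> (L', M', p') \<in> LMB \<and> L = L' \<and>
     pullback (lcarrier L) M p = pullback (lcarrier L') M' p'"
proof -
  have "is_ternary_hom M M' (p' \<circ> inv_into (lcarrier L) p)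
      \<longleftrightarrow> pullback (lcarrier L) M p = pullback (lcarrier L) M' p'"
    if "(L, M, p) \<in> LMB" "(L, M', p') \<in> LMB"
  proof -
    have b: "ternary_system M" "bij_betw p (lcarrier L) (tcarrier M)"
      "ternary_system M'" "bij_betw p' (lcarrier L) (tcarrier M')"
      using that by (auto simp: LMB_iff)
    have "is_ternary_hom (pullback (lcarrier L) M p) (pullback (lcarrier L) M' p') id
        \<longleftrightarrow> pullback (lcarrier L) M p = pullback (lcarrier L) M' p'"
      using b by (intro is_ternary_hom_id_iff ternary_system_pullback) simp_all
    then show ?thesis
      using is_ternary_hom_conj_iff[OF b, of id] by simp
  qed
  then show ?thesis
    unfolding LMB_rel_def by auto
qed

lemma equiv_LMB_rel: "equiv LMB LMB_rel"
  by (rule equivI) (auto simp: refl_on_def sym_def trans_def LMB_rel_iff_same_pullback)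

text \<open>Each class has a unique representative with the identity as its bijection.\<close>

definition standard_triplet :: "'u lquasi \<Rightarrow> 'u ternary \<Rightarrow> 'u triplet" where
  "standard_triplet L M = (L, M, restrict id (lcarrier L))"

lemma standard_triplet_in_LMB:
  assumes "left_quasigroup L" "ternary_system M" "middle_laws M" "tcarrier M = lcarrier L"
  shows "standard_triplet L M \<in> LMB"
proof -
  have "bij_betw (restrict id (lcarrier L)) (lcarrier L) (lcarrier L)"
    by (auto simp: bij_betw_def inj_on_def)
  with assms show ?thesis by (auto simp: standard_triplet_def LMB_iff)
qed

lemma pullback_id:
  assumes "ternary_system M" "tcarrier M = X"
  shows "pullback X M (restrict id X) = M"
proof (rule ternary_eqI)
  have bij: "bij_betw (restrict id X) X (tcarrier M)"
    using assms by (auto simp: bij_betw_def inj_on_def)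
  then show "ternary_system (pullback X M (restrict id X))"
    using assms by (intro ternary_system_pullback)
  have inv: "inv_into X (restrict id X) a = a" if "a \<in> X" for a
    using inv_bij[OF assms(1) bij that] that by simp
  show "tmu (pullback X M (restrict id X)) (a, b, c) = tmu M (a, b, c)"
    if "a \<in> tcarrier (pullback X M (restrict id X))"
      "b \<in> tcarrier (pullback X M (restrict id X))"
      "c \<in> tcarrier (pullback X M (restrict id X))" for a b c
    using that assms inv ternary_system_closed[OF assms(1)]
    by (simp add: pullback_def)
qed (use assms in \<open>simp_all add: pullback_def\<close>)

definition class_of :: "'u lquasi \<Rightarrow> 'u ternary \<Rightarrow> 'u triplet set" where
  "class_of L M = LMB_rel `` {standard_triplet L M}"

lemma in_class_of_iff:
  assumes "standard_triplet L M \<in> LMB" "tcarrier M = lcarrier L"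
  shows "(L', M', p') \<in> class_of L M \<longleftrightarrow>
    (L', M', p') \<in> LMB \<and> L' = L \<and> pullback (lcarrier L) M' p' = M"
proof -
  have "ternary_system M"
    using assms(1) by (simp add: standard_triplet_def LMB_iff)
  then have "pullback (lcarrier L) M (restrict id (lcarrier L)) = M"
    using assms(2) by (rule pullback_id)
  then show ?thesis
    using assms(1) by (auto simp: class_of_def standard_triplet_def LMB_rel_iff_same_pullback)
qed

lemma standard_triplet_in_class_of:
  assumes "standard_triplet L M \<in> LMB"
  shows "standard_triplet L M \<in> class_of L M"
  unfolding class_of_def using equiv_LMB_rel assms by (rule equiv_class_self)

lemma common_L_class_of:
  assumes "standard_triplet L M \<in> LMB" "tcarrier M = lcarrier L"
  shows "common_L (class_of L M) = L"
  unfolding common_L_def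
proof (rule the_equality)
  show "\<exists>M' p. (L, M', p) \<in> class_of L M"
    using standard_triplet_in_class_of[OF assms(1)] by (auto simp: standard_triplet_def)
qed (auto simp: in_class_of_iff[OF assms])

lemma A_hom_class:
  assumes V: "standard_triplet L M \<in> LMB" "tcarrier M = lcarrier L"
    and V': "standard_triplet L' M' \<in> LMB" "tcarrier M' = lcarrier L'"
  shows "f \<in> A_hom (class_of L M) (class_of L' M') \<longleftrightarrow>
    f \<in> lquasi_hom L L' \<and> is_ternary_hom M M' f"
proof (cases "f \<in> lquasi_hom L L'")
  case True
  then have f: "f \<in> lcarrier L \<rightarrow> lcarrier L'"
    by (auto simp: lquasi_hom_def)
  have "is_ternary_hom N N' (p' \<circ> f \<circ> inv_into (lcarrier L) p) \<longleftrightarrow> is_ternary_hom M M' f"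
    if "(L, N, p) \<in> class_of L M" "(L', N', p') \<in> class_of L' M'" for N p N' p'
    using that is_ternary_hom_conj_iff[of N p "lcarrier L" N' p' "lcarrier L'" f] f
    by (simp add: in_class_of_iff[OF V] in_class_of_iff[OF V'] LMB_iff)
  moreover have "\<exists>N p. (L, N, p) \<in> class_of L M" "\<exists>N p. (L', N, p) \<in> class_of L' M'"
    using standard_triplet_in_class_of[OF V(1)] standard_triplet_in_class_of[OF V'(1)]
    unfolding standard_triplet_def by blast+
  moreover have "N = L" if "(N, P, p) \<in> class_of L M" for N P p
    using that by (simp add: in_class_of_iff[OF V])
  moreover have "N = L'" if "(N, P, p) \<in> class_of L' M'" for N P p
    using that by (simp add: in_class_of_iff[OF V'])
  ultimately show ?thesis
    using True unfolding A_hom_def common_L_class_of[OF V] common_L_class_of[OF V'] by blast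
qed (simp add: A_hom_def common_L_class_of[OF V] common_L_class_of[OF V'])

section \<open>The isomorphism of categories\<close>

definition class_of_pair :: "'u dpair \<Rightarrow> 'u triplet set" where
  "class_of_pair = (\<lambda>(L, R). class_of L (middle L R))"

lemma tcarrier_middle [simp]: "tcarrier (middle L R) = lcarrier L"
  by (simp add: middle_def)

lemma D_ob_standard_triplet:
  assumes "(L, R) \<in> D_ob"
  shows "standard_triplet L (middle L R) \<in> LMB"
proof -
  interpret left_quasi L using assms by unfold_locales (simp add: D_ob_def)
  show ?thesis
    using assms by (intro standard_triplet_in_LMB ternary_system_middle) (auto simp: D_ob_iff)
qed

text \<open>
  Injectivity: a class determines \<open>L\<close> and the middle points of \<open>R\<close>, hence \<open>R\<close>.
  Surjectivity: the pulled back operation is the middle point operation of some \<open>R\<close>, which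
  solves the Yang-Baxter equation because the laws survive the pullback.
\<close>

lemma bij_betw_class_of_pair: "bij_betw class_of_pair D_ob (LMB // LMB_rel :: 'u triplet set set)"
  unfolding bij_betw_def
proof
  show "inj_on class_of_pair (D_ob :: 'u dpair set)"
  proof (rule inj_onI)
    fix x y :: "'u dpair"
    assume xy_in: "x \<in> D_ob" "y \<in> D_ob" and xy_eq: "class_of_pair x = class_of_pair y"
    obtain L R L' R' where xy: "x = (L, R)" "y = (L', R')"
      by (cases x; cases y)
    note obs = xy_in[unfolded xy]
    have eq: "class_of L (middle L R) = class_of L' (middle L' R')"
      using xy_eq by (simp add: xy class_of_pair_def)
    note std = D_ob_standard_triplet[OF obs(1)] D_ob_standard_triplet[OF obs(2)]
    have "standard_triplet L (middle L R) \<in> class_of L' (middle L' R')"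
      using standard_triplet_in_class_of[OF std(1)] eq by simp
    then have L: "L = L'" and
      pb: "pullback (lcarrier L) (middle L R) (restrict id (lcarrier L)) = middle L' R'"
      using std by (auto simp: standard_triplet_def in_class_of_iff)
    interpret left_quasi L using obs by unfold_locales (simp add: D_ob_def)
    have inv: "invariant_map L R" "invariant_map L R'"
      using obs L by (auto simp: D_ob_iff)
    have "middle L R = middle L R'"
      using pb pullback_id[OF ternary_system_middle[OF inv(1)]] L by simp
    with invariant_map_eqI[OF inv] L show "x = y" by (simp add: xy)
  qed
  show "class_of_pair ` D_ob = (LMB // LMB_rel :: 'u triplet set set)"
  proof (intro equalityI subsetI)
    fix V :: "'u triplet set" assume "V \<in> class_of_pair ` D_ob"
    then obtain L R where "(L, R) \<in> D_ob" "V = class_of L (middle L R)"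
      by (auto simp: class_of_pair_def)
    then show "V \<in> LMB // LMB_rel"
      using D_ob_standard_triplet by (auto simp: class_of_def intro: quotientI)
  next
    fix V :: "'u triplet set" assume "V \<in> LMB // LMB_rel"
    then obtain L M p where LMp: "(L, M, p) \<in> LMB" and V: "V = LMB_rel `` {(L, M, p)}"
      by (metis prod_cases3 quotientE)
    interpret left_quasi L using LMp by unfold_locales (simp add: LMB_iff)
    define N where "N = pullback X M p"
    have N: "ternary_system N" "middle_laws N" "tcarrier N = X"
      using LMp by (auto simp: N_def LMB_iff ternary_system_pullback middle_laws_pullback)
    note mid = middle_of_map_of_middle[OF N(1,3)]
    have ob: "(L, map_of_middle L N) \<in> D_ob"
      using invariant_map_of_middle[OF N(1,3)] N(2) mid left_quasigroup by (simp add: D_ob_iff)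
    have std: "standard_triplet L N \<in> LMB"
      using N left_quasigroup by (intro standard_triplet_in_LMB)
    have "(L, M, p) \<in> class_of L N"
      using in_class_of_iff[OF std N(3)] LMp by (simp add: N_def)
    then have "V = class_of L N"
      unfolding V class_of_def
      by (metis Image_singleton_iff equiv_LMB_rel equiv_class_eq)
    then have "V = class_of_pair (L, map_of_middle L N)"
      by (simp add: class_of_pair_def mid)
    with ob show "V \<in> class_of_pair ` D_ob" by blast
  qed
qed

theorem theorem4p7:
  "isomorphic_categories
     (cat_A :: ('u triplet set, 'u \<Rightarrow> 'u) cat)
     (cat_D :: ('u dpair, 'u \<Rightarrow> 'u) cat)"
proof (rule isomorphic_categoriesI)
  show "is_category (cat_D :: ('u dpair, 'u \<Rightarrow> 'u) cat)"
    by (rule is_category_cat_D)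
  show "bij_betw class_of_pair (Ob cat_D) (Ob (cat_A :: ('u triplet set, 'u \<Rightarrow> 'u) cat))"
    using bij_betw_class_of_pair by (simp add: cat_A_def cat_D_def)
  have common: "common_L (class_of_pair x) = fst x" if "x \<in> Ob cat_D" for x :: "'u dpair"
    using that common_L_class_of[OF D_ob_standard_triplet]
    by (cases x) (simp add: cat_D_def class_of_pair_def)
  show "Hom cat_A (class_of_pair x) (class_of_pair y) = Hom cat_D x y"
    if "x \<in> Ob cat_D" "y \<in> Ob cat_D" for x y :: "'u dpair"
  proof -
    obtain L R L' R' where xy: "x = (L, R)" "y = (L', R')"
      by (cases x; cases y)
    with that have obs: "(L, R) \<in> D_ob" "(L', R') \<in> D_ob"
      by (simp_all add: cat_D_def)
    then have "f \<in> A_hom (class_of_pair x) (class_of_pair y) \<longleftrightarrow> f \<in> D_hom x y" for f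
      by (simp add: xy class_of_pair_def A_hom_class D_ob_standard_triplet D_hom_iff_middle_hom
          D_ob_iff del: D_hom.simps)
    then show ?thesis
      by (auto simp: cat_A_def cat_D_def)
  qed
  show "Ident cat_A (class_of_pair x) = Ident cat_D x" if "x \<in> Ob cat_D" for x :: "'u dpair"
    using common[OF that] by (simp add: cat_A_def cat_D_def split_beta)
  show "Comp cat_A (class_of_pair x) (class_of_pair y) (class_of_pair z) = Comp cat_D x y z"
    if "x \<in> Ob cat_D" for x y z :: "'u dpair"
    using common[OF that] by (simp add: cat_A_def cat_D_def)
qed

end
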